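(* Let $G$ be a 3-connected plane graph with auxiliary graph $G^\nabla$. For every minimal cut $R$ of $G$, there exists a unique minimal cut $S$ of $G^\nabla$ such that $S\cap V(G)=R$.
   Context: A large face of a 2-connected plane graph is a face whose bounding cycle has length at least 4. The auxiliary graph $G^\nabla$ is obtained from $G$ by adding, for each large face $W$, a new vertex placed inside $W$ and joined to every vertex of $W$. A cut of a connected graph $H=(V,E)$ is a set $S\subset V$ with $H-S$ disconnected; it is minimal if $H-T$ is connected for every proper subset $T\subset S$. *)

theory Defs
  imports "HOL-Analysis.Analysis" "Graph_Theory.Graph_Theory"
begin

text \<open>
  A plane graph consists of a finite set \<open>V\<close> of points of the plane and a set \<open>E\<close> of edges,
  where an edge is the point set of a simple arc that meets \<open>V\<close> exactly in its two end points.
  Distinct edges have distinct pairs of ends (so the graph is simple) and meet in vertices only.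
  The ends of an edge \<open>e\<close> are therefore the two elements of \<open>e \<inter> V\<close>.
\<close>

locale plane_graph =
  fixes V :: "complex set" and E :: "complex set set"
  assumes finite_V: "finite V"
    and edge_arc: "e \<in> E \<Longrightarrow> \<exists>g. arc g \<and> path_image g = e \<and> e \<inter> V = {pathstart g, pathfinish g}"
    and edge_disjoint: "e \<in> E \<Longrightarrow> f \<in> E \<Longrightarrow> e \<noteq> f \<Longrightarrow> e \<inter> f \<subseteq> V"
    and edge_simple: "e \<in> E \<Longrightarrow> f \<in> E \<Longrightarrow> e \<inter> V = f \<inter> V \<Longrightarrow> e = f"

text \<open>As usual in the graph library, an undirected graph is a symmetric digraph.\<close>

definition graph_of :: "complex set \<Rightarrow> complex set set \<Rightarrow> complex pair_pre_digraph" where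
  "graph_of V E = \<lparr>pverts = V, parcs = {(u, v). \<exists>e\<in>E. e \<inter> V = {u, v}}\<rparr>"

definition faces :: "complex set \<Rightarrow> complex set set \<Rightarrow> complex set set" where
  "faces V E = components (- (V \<union> \<Union>E))"

text \<open>
  The bound on the length is needed since a single edge traversed back and forth is a cycle of
  length 2 of the symmetric digraph.
\<close>

definition bounding_cycle ::
    "complex set \<Rightarrow> complex set set \<Rightarrow> complex set \<Rightarrow> (complex \<times> complex) list \<Rightarrow> bool" where
  "bounding_cycle V E W p \<longleftrightarrow>
     pre_digraph.cycle (graph_of V E) p \<and> length p \<ge> 3 \<and>
     frontier W = \<Union>{e \<in> E. \<exists>(u, v) \<in> set p. e \<inter> V = {u, v}}"

definition large_faces :: "complex set \<Rightarrow> complex set set \<Rightarrow> complex set set" where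
  "large_faces V E = {W \<in> faces V E. \<exists>p. bounding_cycle V E W p \<and> length p \<ge> 4}"

text \<open>\<open>c W\<close> is the position of the vertex that is added in the large face \<open>W\<close>.\<close>

definition nabla ::
    "complex set \<Rightarrow> complex set set \<Rightarrow> (complex set \<Rightarrow> complex) \<Rightarrow> complex pair_pre_digraph" where
  "nabla V E c =
     \<lparr>pverts = V \<union> c ` large_faces V E,
      parcs = parcs (graph_of V E)
        \<union> {(c W, v) | W v. W \<in> large_faces V E \<and> v \<in> V \<inter> frontier W}
        \<union> {(v, c W) | W v. W \<in> large_faces V E \<and> v \<in> V \<inter> frontier W}\<rparr>"

text \<open>
  Connectedness of graphs in the graph library requires a nonempty vertex set. The null graph is
  never tested for connectedness below, as only proper subsets of the vertex set are deleted.
\<close>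

abbreviation delete_verts :: "('a, 'b) pre_digraph \<Rightarrow> 'a set \<Rightarrow> ('a, 'b) pre_digraph" where
  "delete_verts G S \<equiv> G \<restriction> (verts G - S)"

definition k_connected :: "nat \<Rightarrow> ('a, 'b) pre_digraph \<Rightarrow> bool" where
  "k_connected k G \<longleftrightarrow> card (verts G) > k \<and>
     (\<forall>X \<subseteq> verts G. card X < k \<longrightarrow> Digraph_Component.connected (delete_verts G X))"

definition vertex_cut :: "('a, 'b) pre_digraph \<Rightarrow> 'a set \<Rightarrow> bool" where
  "vertex_cut G S \<longleftrightarrow> S \<subset> verts G \<and> \<not> Digraph_Component.connected (delete_verts G S)"

definition minimal_cut :: "('a, 'b) pre_digraph \<Rightarrow> 'a set \<Rightarrow> bool" where
  "minimal_cut G S \<longleftrightarrow> vertex_cut G S \<and> (\<forall>T \<subset> S. Digraph_Component.connected (delete_verts G T))"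

end

theory Submission
  imports Defs
begin

text \<open>
  Every vertex of a minimal cut \<open>R\<close> of \<open>G\<close> has a neighbour in every component of \<open>G - R\<close>, and \<open>R\<close> has
  at least three vertices. A third component of \<open>G - R\<close>, or a large face all of whose vertices lie
  in \<open>R\<close>, would therefore give a plane drawing of \<open>K\<^sub>3\<^sub>,\<^sub>3\<close>. So \<open>G - R\<close> has exactly two
  components, and every vertex added in a large face has a neighbour in at least one of them.
  Hence the added vertices that must be deleted together with \<open>R\<close> are exactly those with
  neighbours in both components.
\<close>

hide_const (open) Digraph_Component.connected

subsection \<open>Plane topology\<close>

text \<open>Follow a path from \<open>c\<close> to \<open>z\<close> up to its first point
  \<open>u\<close> on \<open>J\<close>. The piece \<open>P\<close> before \<open>u\<close> is
  half-open, so that it misses \<open>J\<close> and yet accumulates at \<open>u\<close>.\<close>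

lemma path_first_hit:
  fixes Y :: "'a::real_normed_vector set"
  assumes "path_connected Y" "closed J" "c \<in> Y" "c \<notin> J" "z \<in> Y" "z \<in> J"
  obtains P u where "connected P" "c \<in> P" "P \<inter> J = {}" "P \<subseteq> Y" "u \<in> J" "u \<in> Y"
    "compact (insert u P)" "u \<in> closure P"
proof -
  obtain g where g: "path g" "path_image g \<subseteq> Y" "pathstart g = c" "pathfinish g = z"
    using assms unfolding path_connected_def by blast
  have "pathfinish g \<notin> - J" using g assms by simp
  then obtain t where t: "0 \<le> t" "t \<le> 1" "\<And>x. 0 \<le> x \<and> x < t \<Longrightarrow> g x \<in> interior (- J)"
    "g t \<notin> interior (- J)"
    using subpath_to_frontier_explicit[OF g(1)] by metis
  have int: "interior (- J) = - J"
    using assms(2) by (simp add: interior_open open_Compl)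
  have cont: "continuous_on {0..t} g"
    using g(1) t unfolding path_def by (auto intro: continuous_on_subset)
  have "t \<noteq> 0"
    using t(4) g(3) assms(4) int by (auto simp: pathstart_def)
  then have t0: "0 < t" using t by simp
  show thesis
  proof
    show "connected (g ` {0..<t})"
      by (intro connected_continuous_image continuous_on_subset[OF cont]) auto
    show "c \<in> g ` {0..<t}"
      using t0 g(3) by (force simp: pathstart_def)
    show "g ` {0..<t} \<inter> J = {}"
      using t(3) int by auto
    show "g ` {0..<t} \<subseteq> Y" "g t \<in> Y"
      using g(2) t by (auto simp: path_image_def)
    show "g t \<in> J" using t(4) int by auto
    have "{0..t} = insert t {0..<t}" using t0 by auto
    then have "insert (g t) (g ` {0..<t}) = g ` {0..t}" by auto
    then show "compact (insert (g t) (g ` {0..<t}))"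
      using compact_continuous_image[OF cont] by simp
    have "g ` closure {0..<t} \<subseteq> closure (g ` {0..<t})"
      using t0 cont by (intro image_closure_subset) (auto simp: closure_subset)
    then show "g t \<in> closure (g ` {0..<t})"
      using t0 by auto
  qed
qed

text \<open>The cut is made at half the parameter of \<open>u\<close>; injectivity keeps
  \<open>u\<close> off \<open>N\<close> and the start off \<open>M\<close>. So the start can be left
  along \<open>N\<close> without meeting \<open>u\<close>.\<close>

lemma arc_initial_piece:
  fixes g :: "real \<Rightarrow> 'a::t2_space"
  assumes "arc g" "u \<in> path_image g" "u \<noteq> pathstart g"
  obtains N M where "compact N" "connected N" "compact M" "path_image g = N \<union> M"
    "pathstart g \<in> N" "pathstart g \<notin> M" "u \<notin> N"
proof -
  obtain s where s: "s \<in> {0..1}" "u = g s" using assms(2) by (auto simp: path_image_def)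
  have s0: "0 < s" using s assms(3) by (cases "s = 0") (auto simp: pathstart_def)
  have cont: "continuous_on {0..1} g" and inj: "inj_on g {0..1}"
    using assms(1) by (auto simp: arc_def path_def)
  show thesis
  proof
    show "compact (g ` {0..s/2})" "compact (g ` {s/2..1})" "connected (g ` {0..s/2})"
      using s s0 by (auto intro!: compact_continuous_image connected_continuous_image
          continuous_on_subset[OF cont])
    have "{0..1} = {0..s/2} \<union> {s/2..1}" using s s0 by auto
    then show "path_image g = g ` {0..s/2} \<union> g ` {s/2..1}"
      unfolding path_image_def by (metis image_Un)
    show "pathstart g \<in> g ` {0..s/2}" using s0 by (auto simp: pathstart_def)
    show "pathstart g \<notin> g ` {s/2..1}"
    proof
      assume "pathstart g \<in> g ` {s/2..1}"
      then obtain x where x: "x \<in> {s/2..1}" "g 0 = g x" by (auto simp: pathstart_def)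
      then have "0 = x" using inj s0 s by (auto dest!: inj_onD)
      then show False using x s0 by auto
    qed
    show "u \<notin> g ` {0..s/2}"
    proof
      assume "u \<in> g ` {0..s/2}"
      then obtain x where x: "x \<in> {0..s/2}" "g s = g x" using s by auto
      then have "s = x" using inj s0 s by (auto dest!: inj_onD)
      then show False using x s0 by auto
    qed
  qed
qed

text \<open>This replaces accessibility of \<open>a\<close> from \<open>X\<close>. Near
  \<open>a\<close> only \<open>N\<close> belongs to \<open>T\<close>, so a point \<open>x\<close> of
  \<open>X\<close> close to \<open>a\<close> has its nearest point \<open>y\<close> of
  \<open>T\<close> in \<open>N\<close>; the set \<open>Q\<close> consists of \<open>N\<close> and
  the segment from \<open>x\<close> to \<open>y\<close>.\<close>

lemma component_approach:
  fixes T :: "'a::euclidean_space set"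
  assumes X: "X \<in> components (- T)" and T: "closed T" "T = N \<union> M"
    and N: "compact N" "connected N" "a \<in> N" and M: "closed M" "a \<notin> M" and a: "a \<in> closure X"
  obtains Q x where "compact Q" "connected Q" "a \<in> Q" "x \<in> Q" "x \<in> X" "Q \<subseteq> N \<union> X"
proof -
  obtain d where d: "0 < d" "ball a d \<subseteq> - M"
    using M by (metis Compl_iff open_Compl open_contains_ball)
  obtain x where x: "x \<in> X" "dist x a < d / 2"
    using a d(1) by (metis closure_approachable half_gt_zero)
  have "T \<noteq> {}" using T N by auto
  then obtain y where y: "y \<in> T" "\<And>z. z \<in> T \<Longrightarrow> dist x y \<le> dist x z"
    using distance_attains_inf[OF T(1)] by metis
  have "dist x y \<le> dist x a" using y T N by auto
  then have "dist a y < d"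
    using x(2) dist_triangle[of a y x] by (simp add: dist_commute)
  then have yN: "y \<in> N" using y(1) T(2) d(2) by auto
  have xT: "x \<notin> T" using X x(1) in_components_subset by blast
  then have "x \<noteq> y" using y by auto
  define L where "L = closed_segment x y - {y}"
  \<comment> \<open>A point of \<open>T\<close> on the segment other than \<open>y\<close> would be
    nearer to \<open>x\<close> than \<open>y\<close> is.\<close>
  have "L \<inter> T = {}"
  proof -
    have "z = y" if z: "z \<in> closed_segment x y" "z \<in> T" for z
    proof -
      have "dist x y = dist x z + dist z y"
        using z(1) between between_mem_segment by (metis dist_commute)
      then show ?thesis using y(2)[OF z(2)] by simp
    qed
    then show ?thesis by (auto simp: L_def)
  qed
  moreover have "connected L"
  proof -
    have "open_segment x y \<subseteq> L" "L \<subseteq> closure (open_segment x y)"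
      using \<open>x \<noteq> y\<close> closure_open_segment[of x y]
      by (auto simp: L_def open_segment_def simp del: closure_open_segment)
    then show ?thesis
      using connected_intermediate_closure[OF convex_connected[OF convex_open_segment]] by metis
  qed
  ultimately have "L \<subseteq> X"
    using components_maximal[OF X, of L] x \<open>x \<noteq> y\<close> by (auto simp: L_def)
  show thesis
  proof
    show "compact (N \<union> closed_segment x y)" using N by auto
    show "connected (N \<union> closed_segment x y)"
      using N yN by (intro connected_Un) auto
    show "a \<in> N \<union> closed_segment x y" "x \<in> N \<union> closed_segment x y" "x \<in> X"
      using N x by auto
    show "N \<union> closed_segment x y \<subseteq> N \<union> X"
      using \<open>L \<subseteq> X\<close> yN by (auto simp: L_def)
  qed
qed

text \<open>The side of the curve not containing \<open>P\<close> joins \<open>P\<close> to that side around either arc, so the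
  set \<open>Q\<close> would have to separate the two sides; Janiszewski's theorem excludes this.\<close>

lemma no_crossing_chords:
  fixes g1 g2 :: "real \<Rightarrow> complex"
  defines "J \<equiv> path_image g1 \<union> path_image g2"
  assumes arcs: "arc g1" "arc g2" "pathstart g1 = a" "pathfinish g1 = b"
      "pathstart g2 = a" "pathfinish g2 = b" "path_image g1 \<inter> path_image g2 = {a, b}"
    and P: "connected P" "p \<in> P" "P \<inter> J = {}"
    and u: "u \<in> path_image g1" "u \<notin> {a, b}" "u \<in> closure P"
    and v: "v \<in> path_image g2" "v \<notin> {a, b}" "v \<in> closure P"
    and Q: "compact Q" "connected Q" "a \<in> Q" "b \<in> Q" "Q \<inter> P = {}" "u \<notin> Q" "v \<notin> Q"
      "Q \<subseteq> J \<union> connected_component_set (- J) p"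
  shows False
proof -
  define h where "h = g1 +++ reversepath g2"
  have h: "simple_path h" "pathfinish h = pathstart h" "path_image h = J"
    using arcs unfolding h_def J_def
    by (auto simp: path_image_join arc_reversepath intro!: simple_path_join_loop)
  obtain I O' where IO: "I \<noteq> {}" "connected I" "open I" "O' \<noteq> {}" "connected O'" "open O'"
    "I \<inter> O' = {}" "I \<union> O' = - J" "frontier I = J" "frontier O' = J"
    using Jordan_curve[OF h(1,2)] h(3) by metis
  \<comment> \<open>\<open>D'\<close> is the side of the Jordan curve \<open>J\<close> that contains
    \<open>p\<close>, and \<open>D\<close> is the other side.\<close>
  have "\<exists>D D'. connected D \<and> D \<noteq> {} \<and> D \<inter> D' = {} \<and> D \<union> D' = - J \<and> frontier D = J \<and>
     open D \<and> open D' \<and> p \<in> D'"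
    proof (cases "p \<in> I")
    case True
    then show ?thesis using IO by (intro exI[of _ O'] exI[of _ I]) auto
  next
    case False
    then have "p \<in> O'" using IO(8) P by blast
    then show ?thesis using IO by (intro exI[of _ I] exI[of _ O']) auto
  qed
  then obtain D D' where D: "connected D" "D \<noteq> {}" "D \<inter> D' = {}" "D \<union> D' = - J"
    "frontier D = J" "open D" "open D'" "p \<in> D'" by blast
  have inD': "B \<subseteq> D'" if "connected B" "p \<in> B" "B \<subseteq> - J" for B
  proof -
    have "D \<inter> B = {}"
      using connectedD[OF that(1) D(6) D(7)] that D by blast
    then show ?thesis using that D by blast
  qed
  have "connected_component_set (- J) p \<subseteq> D'"
    using inD'[of "connected_component_set (- J) p"] P
    by (metis ComplI connected_component_refl_eq connected_component_subset
        connected_connected_component disjoint_iff mem_Collect_eq)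
  then have QD: "Q \<inter> D = {}" using Q(8) D by blast
  obtain q where q: "q \<in> D" using D by blast
  \<comment> \<open>Both \<open>P\<close> and \<open>D\<close> accumulate at \<open>w\<close>, every
    point of \<open>J\<close> being on the frontier of \<open>D\<close>. So they hang together
    through \<open>w\<close>, off the arc \<open>g\<close> and off \<open>Q\<close>.\<close>
  have cc: "connected_component (- (path_image g \<union> Q)) p q"
    if "path_image g \<subseteq> J" "w \<in> J" "w \<notin> path_image g" "w \<notin> Q" "w \<in> closure P" for g w
  proof -
    have wD: "w \<in> closure D" using D(5) that(2) by (auto simp: frontier_def)
    have "connected (insert w P)" "connected (insert w D)"
      using that(5) wD closure_subset[of P] closure_subset[of D]
      by (intro connected_intermediate_closure[OF P(1)] connected_intermediate_closure[OF D(1)]; blast)+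
    then have "connected (insert w P \<union> insert w D)" by (intro connected_Un) auto
    moreover have "insert w P \<union> insert w D \<subseteq> - (path_image g \<union> Q)"
      using that P(3) D(4) QD Q(5) by blast
    ultimately show ?thesis
      unfolding connected_component_def using P(2) q by blast
  qed
  have "u \<notin> path_image g2" "v \<notin> path_image g1" using u v arcs(7) by blast+
  then have 1: "connected_component (- (path_image g1 \<union> Q)) p q"
    and 2: "connected_component (- (path_image g2 \<union> Q)) p q"
    using u v Q cc[of g1 v] cc[of g2 u] by (auto simp: J_def)
  \<comment> \<open>The arcs meet only in \<open>a\<close> and \<open>b\<close>, which belong to
    \<open>Q\<close>. Janiszewski's theorem needs this intersection to be connected.\<close>
  have eq: "(path_image g1 \<union> Q) \<inter> (path_image g2 \<union> Q) = Q"
    using arcs(7) Q(3,4) by auto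
  have "connected_component (- ((path_image g1 \<union> Q) \<union> (path_image g2 \<union> Q))) p q"
    using arcs Q(1,2) eq
    by (intro Janiszewski 1 2) (auto simp: compact_Un compact_arc_image compact_imp_closed)
  then obtain B where "connected B" "B \<subseteq> - J" "p \<in> B" "q \<in> B"
    unfolding connected_component_def J_def by blast
  then show False using inD' q D by blast
qed

text \<open>A form of the non-planarity of \<open>K\<^sub>3\<^sub>,\<^sub>3\<close>. The third set \<open>X\<close> only needs to accumulate at
  the three points, so that it can also be a face.\<close>

lemma no_plane_K33:
  fixes a b c :: complex
  assumes ne: "a \<noteq> b" "a \<noteq> c" "b \<noteq> c"
    and U: "path_connected (insert a U)" "path_connected (insert b U)" "path_connected (insert c U)"
    and U': "path_connected (insert a U')" "path_connected (insert b U')"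
      "path_connected (insert c U')"
    and disj: "U \<noteq> {}" "U' \<noteq> {}" "U \<inter> U' = {}" "{a, b, c} \<inter> (U \<union> U') = {}"
    and X: "connected X" "X \<inter> (U \<union> U' \<union> {a, b, c}) = {}" "{a, b, c} \<subseteq> closure X"
  shows False
proof -
  have ins2: "path_connected (insert x (insert y W))"
    if "path_connected (insert x W)" "path_connected (insert y W)" "W \<noteq> {}" for x y and W :: "complex set"
  proof -
    have "path_connected (insert x W \<union> insert y W)"
      using that by (intro path_connected_Un) auto
    then show ?thesis by (simp add: insert_commute)
  qed
  obtain g1 where g1: "arc g1" "path_image g1 \<subseteq> insert a (insert b U)" "pathstart g1 = a" "pathfinish g1 = b"
    using ins2[OF U(1,2) disj(1)] ne(1) unfolding path_connected_arcwise by blast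
  obtain g2 where g2: "arc g2" "path_image g2 \<subseteq> insert a (insert b U')" "pathstart g2 = a" "pathfinish g2 = b"
    using ins2[OF U'(1,2) disj(2)] ne(1) unfolding path_connected_arcwise by blast
  define J where "J = path_image g1 \<union> path_image g2"
  have ab: "a \<in> path_image g1" "b \<in> path_image g1" "a \<in> path_image g2" "b \<in> path_image g2"
    using g1 g2 by (metis pathfinish_in_path_image pathstart_in_path_image)+
  have int: "path_image g1 \<inter> path_image g2 = {a, b}" using g1 g2 ab disj(3) by blast
  have cJ: "c \<notin> J" using g1(2) g2(2) disj(4) ne by (auto simp: J_def)
  have clJ: "compact J" using g1 g2 by (simp add: J_def compact_arc_image compact_Un)
  \<comment> \<open>An arc is a connected set with more than one point, hence infinite. Inner points
    of \<open>g1\<close> and \<open>g2\<close> lie in \<open>U\<close> and \<open>U'\<close> and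
    serve as targets on \<open>J\<close> for paths from \<open>c\<close>.\<close>
  have inner: "\<exists>z. z \<in> path_image g \<and> z \<notin> {a, b}" if "arc g" "pathstart g = a" "pathfinish g = b" for g
  proof -
    have "infinite (path_image g)"
      using that(1) ne(1) ab
      by (metis connected_arc_image connected_finite_iff_sing empty_iff insert_iff
          pathfinish_in_path_image pathstart_in_path_image that(2) that(3))
    then show ?thesis
      by (metis finite.emptyI finite_insert finite_subset subsetI)
  qed
  obtain z1 where z1: "z1 \<in> path_image g1" "z1 \<notin> {a, b}" using inner g1 by blast
  obtain z2 where z2: "z2 \<in> path_image g2" "z2 \<notin> {a, b}" using inner g2 by blast
  obtain P1 u where P1: "connected P1" "c \<in> P1" "P1 \<inter> J = {}" "P1 \<subseteq> insert c U" "u \<in> J"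
    "u \<in> insert c U" "compact (insert u P1)" "u \<in> closure P1"
    by (rule path_first_hit[OF U(3) compact_imp_closed[OF clJ], of c z1])
       (use z1 g1 cJ in \<open>auto simp: J_def\<close>)
  obtain P2 v where P2: "connected P2" "c \<in> P2" "P2 \<inter> J = {}" "P2 \<subseteq> insert c U'" "v \<in> J"
    "v \<in> insert c U'" "compact (insert v P2)" "v \<in> closure P2"
    by (rule path_first_hit[OF U'(3) compact_imp_closed[OF clJ], of c z2])
       (use z2 g2 cJ in \<open>auto simp: J_def\<close>)
  \<comment> \<open>\<open>P\<close> is a chord of \<open>J\<close> from \<open>u\<close> through
    \<open>c\<close> to \<open>v\<close> without its ends; \<open>PP\<close> includes the
    ends.\<close>
  define P where "P = P1 \<union> P2"
  define PP where "PP = insert u P1 \<union> insert v P2"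
  have P: "connected P" "c \<in> P" "P \<inter> J = {}" "u \<in> closure P" "v \<in> closure P" "compact PP"
  proof -
    show "connected P" using P1(1,2) P2(1,2) unfolding P_def by (intro connected_Un) auto
    show "compact PP" using compact_Un[OF P1(7) P2(7)] by (simp only: PP_def)
  qed (use P1(2,3,8) P2(2,3,8) in \<open>auto simp: P_def\<close>)
  have u: "u \<in> path_image g1" "u \<notin> {a, b}" "u \<notin> path_image g2"
    using P1(5,6) cJ g1(2) g2(2) disj by (auto simp: J_def)
  have v: "v \<in> path_image g2" "v \<notin> {a, b}" "v \<notin> path_image g1"
    using P2(5,6) cJ g1(2) g2(2) disj by (auto simp: J_def)
  \<comment> \<open>\<open>X\<close> will be enlarged to a component \<open>X'\<close> of the
    complement of \<open>J\<close> and the chord. This set is open, so paths can be drawn inside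
    it.\<close>
  define T where "T = J \<union> PP"
  have "T \<subseteq> U \<union> U' \<union> {a, b, c}"
    using g1(2) g2(2) P1(4) P2(4) u v by (auto simp: T_def J_def PP_def)
  then have XT: "X \<subseteq> - T" using X(2) by blast
  have clT: "closed T" using clJ P(6) by (simp add: T_def compact_Un compact_imp_closed)
  have "X \<noteq> {}" using X(3) by auto
  then obtain X' where X': "X' \<in> components (- T)" "X \<subseteq> X'"
    using exists_component_superset[OF XT _ X(1)] XT by blast
  have clX': "a \<in> closure X'" "b \<in> closure X'" "c \<in> closure X'"
    using X(3) closure_mono[OF X'(2)] by auto
  have opX': "open X'" using X'(1) clT by (metis open_Compl open_components)
  have coX': "connected X'" using X'(1) in_components_connected by blast
  \<comment> \<open>From an end \<open>e\<close> the set \<open>X'\<close> is reached along initial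
    pieces of both arcs that stop before \<open>u\<close> and \<open>v\<close>. The parametrisations
    \<open>h1\<close> and \<open>h2\<close> start at \<open>e\<close>, so \<open>b\<close> is
    covered by reversing the arcs.\<close>
  have reach: "\<exists>Q x. compact Q \<and> connected Q \<and> e \<in> Q \<and> x \<in> Q \<and> x \<in> X' \<and> Q \<subseteq> J \<union> X' \<and> Q \<inter> PP = {}"
    if h1: "arc h1" "path_image h1 = path_image g1" "pathstart h1 = e"
    and h2: "arc h2" "path_image h2 = path_image g2" "pathstart h2 = e"
    and e: "e \<in> {a, b}" for e h1 h2
  proof -
    obtain N1 M1 where 1: "compact N1" "connected N1" "compact M1" "path_image g1 = N1 \<union> M1"
      "e \<in> N1" "e \<notin> M1" "u \<notin> N1"
      using arc_initial_piece[OF h1(1), of u] h1 u e by metis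
    obtain N2 M2 where 2: "compact N2" "connected N2" "compact M2" "path_image g2 = N2 \<union> M2"
      "e \<in> N2" "e \<notin> M2" "v \<notin> N2"
      using arc_initial_piece[OF h2(1), of v] h2 v e by metis
    have ePP: "e \<notin> PP" using e u v ab P1(3) P2(3) by (auto simp: PP_def J_def)
    obtain Q x where Q: "compact Q" "connected Q" "e \<in> Q" "x \<in> Q" "x \<in> X'" "Q \<subseteq> (N1 \<union> N2) \<union> X'"
    proof (rule component_approach[OF X'(1) clT, of "N1 \<union> N2" "M1 \<union> M2 \<union> PP" e])
      show "T = N1 \<union> N2 \<union> (M1 \<union> M2 \<union> PP)" using 1 2 by (auto simp: T_def J_def)
      show "compact (N1 \<union> N2)" "connected (N1 \<union> N2)" "e \<in> N1 \<union> N2"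
        using 1 2 by (auto intro!: connected_Un)
      show "closed (M1 \<union> M2 \<union> PP)" using 1 2 P by (auto intro!: compact_imp_closed)
      show "e \<notin> M1 \<union> M2 \<union> PP" using 1 2 ePP by auto
      show "e \<in> closure X'" using clX' e by auto
    qed
    have "(N1 \<union> N2) \<inter> PP = {}"
      using 1 2 u v P1(3) P2(3) by (auto simp: PP_def J_def)
    moreover have "X' \<inter> PP = {}" using in_components_subset[OF X'(1)] by (auto simp: T_def)
    ultimately show ?thesis
      using Q 1 2 by (intro exI[of _ Q] exI[of _ x]) (auto simp: J_def)
  qed
  obtain Qa xa where Qa: "compact Qa" "connected Qa" "a \<in> Qa" "xa \<in> Qa" "xa \<in> X'" "Qa \<subseteq> J \<union> X'" "Qa \<inter> PP = {}"
    using reach[of g1 a g2] g1 g2 by auto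
  obtain Qb xb where Qb: "compact Qb" "connected Qb" "b \<in> Qb" "xb \<in> Qb" "xb \<in> X'" "Qb \<subseteq> J \<union> X'" "Qb \<inter> PP = {}"
    using reach[of "reversepath g1" b "reversepath g2"] g1 g2 by (auto simp: arc_reversepath)
  obtain k where k: "path k" "path_image k \<subseteq> X'" "pathstart k = xa" "pathfinish k = xb"
    using connected_open_path_connected[OF opX' coX'] Qa(5) Qb(5) unfolding path_connected_def by blast
  \<comment> \<open>\<open>Q\<close> connects \<open>a\<close> and \<open>b\<close> through
    \<open>X'\<close> and avoids the chord from \<open>u\<close> to \<open>v\<close>, although the
    four points alternate on \<open>J\<close>.\<close>
  define Q where "Q = Qa \<union> path_image k \<union> Qb"
  have k': "xa \<in> path_image k" "xb \<in> path_image k"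
    using k by (metis pathfinish_in_path_image pathstart_in_path_image)+
  have "X' \<inter> PP = {}" "X' \<subseteq> - J" using in_components_subset[OF X'(1)] by (auto simp: T_def)
  have Q: "compact Q" "connected Q" "a \<in> Q" "b \<in> Q" "Q \<inter> PP = {}" "Q \<subseteq> J \<union> X'"
    using Qa Qb k k' \<open>X' \<inter> PP = {}\<close>
    by (auto simp: Q_def compact_path_image connected_path_image intro!: connected_Un)
  \<comment> \<open>\<open>X'\<close> lies on the same side of \<open>J\<close> as \<open>c\<close>,
    because it accumulates at \<open>c\<close> and that side is open.\<close>
  have "X' \<subseteq> connected_component_set (- J) c"
  proof -
    let ?O = "connected_component_set (- J) c"
    have "open ?O" using clJ by (intro open_connected_component open_Compl compact_imp_closed)
    moreover have "c \<in> ?O" using cJ by simp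
    ultimately have "?O \<inter> X' \<noteq> {}" using clX'(3) open_Int_closure_eq_empty[of ?O X'] by blast
    then obtain x where x: "x \<in> ?O" "x \<in> X'" by blast
    then have "X' \<subseteq> connected_component_set (- J) x"
      using coX' \<open>X' \<subseteq> - J\<close> by (intro connected_component_maximal)
    then show ?thesis using x(1) by (metis connected_component_eq)
  qed
  then have QJ: "Q \<subseteq> J \<union> connected_component_set (- J) c" using Q(6) by blast
  have "Q \<inter> P = {}" "u \<notin> Q" "v \<notin> Q" using Q(5) by (auto simp: PP_def P_def)
  then show False
    using no_crossing_chords[of g1 g2 a b P c u v Q] g1 g2 int P u v Q QJ
    by (simp add: J_def)
qed

subsection \<open>Cuts of symmetric digraphs\<close>

text \<open>Connectedness of the subgraph induced on \<open>U\<close>, stated for the bare arc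
  relation. Directed reachability suffices for symmetric relations, and nonemptiness matches
  connectedness of digraphs.\<close>

definition linked :: "('a \<times> 'a) set \<Rightarrow> 'a set \<Rightarrow> bool" where
  "linked A U \<longleftrightarrow> U \<noteq> {} \<and> (\<forall>u\<in>U. \<forall>v\<in>U. (u, v) \<in> (A \<inter> U \<times> U)\<^sup>*)"

lemma connected_induce_iff_linked:
  assumes "sym (parcs H)"
  shows "Digraph_Component.connected (with_proj H \<restriction> U) \<longleftrightarrow> linked (parcs H) U"
proof -
  have 1: "arcs_ends (with_proj H \<restriction> U) = parcs H \<inter> U \<times> U"
    by (auto simp: arcs_ends_conv image_iff)
  have 2: "(parcs H \<inter> U \<times> U)\<^sup>s = parcs H \<inter> U \<times> U"
    using assms by (auto simp: symcl_def dest: symD)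
  have 3: "(u, v) \<in> rtrancl_on U (parcs H \<inter> U \<times> U) \<longleftrightarrow> (u, v) \<in> (parcs H \<inter> U \<times> U)\<^sup>*"
    if "u \<in> U" "v \<in> U" for u v
    using that by (auto intro: rtrancl_on_rtranclI rtrancl_consistent_rtrancl_on)
  show ?thesis
    unfolding connected_conv 1 2 linked_def using 3 by auto
qed

lemma minimal_cut_iff_linked:
  assumes "sym (parcs H)"
  shows "minimal_cut (with_proj H) S \<longleftrightarrow> S \<subset> pverts H \<and> \<not> linked (parcs H) (pverts H - S) \<and>
    (\<forall>T \<subset> S. linked (parcs H) (pverts H - T))"
  unfolding minimal_cut_def vertex_cut_def
  using connected_induce_iff_linked[OF assms] by simp

lemma linked_closed_subset:
  assumes "linked A U" "C \<subseteq> U" "C \<noteq> {}" "\<And>y z. y \<in> C \<Longrightarrow> z \<in> U \<Longrightarrow> (y, z) \<in> A \<Longrightarrow> z \<in> C"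
  shows "C = U"
proof -
  obtain x where x: "x \<in> C" using assms(3) by blast
  have "y \<in> C" if "y \<in> U" for y
  proof -
    have "(x, y) \<in> (A \<inter> U \<times> U)\<^sup>*" using assms(1,2) x that by (auto simp: linked_def)
    then show ?thesis by induction (use x assms(4) in auto)
  qed
  then show ?thesis using assms(2) by blast
qed

lemma linked_mono:
  assumes "linked A U" "A \<inter> U \<times> U \<subseteq> B"
  shows "linked B U"
proof -
  have "(A \<inter> U \<times> U)\<^sup>* \<subseteq> (B \<inter> U \<times> U)\<^sup>*" using assms(2) by (intro rtrancl_mono) auto
  then show ?thesis using assms(1) by (auto simp: linked_def)
qed

lemma linkedI_root:
  assumes "sym A" "x \<in> U" "\<And>y. y \<in> U \<Longrightarrow> (x, y) \<in> (A \<inter> U \<times> U)\<^sup>*"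
  shows "linked A U"
proof -
  have "sym ((A \<inter> U \<times> U)\<^sup>*)"
    using assms(1) by (intro sym_rtrancl) (auto simp: sym_def)
  then show ?thesis
    unfolding linked_def using assms(2,3) by (meson empty_iff rtrancl_trans symD)
qed

text \<open>The blocks are the connected components of the subgraph induced on \<open>U\<close>, not
  blocks in the sense of 2-connectivity.\<close>

definition block :: "('a \<times> 'a) set \<Rightarrow> 'a set \<Rightarrow> 'a set \<Rightarrow> bool" where
  "block A U C \<longleftrightarrow> C \<subseteq> U \<and> linked A C \<and> (\<forall>y\<in>C. \<forall>z\<in>U. (y, z) \<in> A \<longrightarrow> z \<in> C)"

lemma ex_block:
  assumes "sym A" "x \<in> U"
  shows "block A U {y. (x, y) \<in> (A \<inter> U \<times> U)\<^sup>*}" (is "block A U ?C")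
proof -
  have sub: "?C \<subseteq> U"
  proof
    fix y assume "y \<in> ?C"
    then have "(x, y) \<in> (A \<inter> U \<times> U)\<^sup>*" by simp
    then show "y \<in> U" by induction (use assms in auto)
  qed
  have closed: "z \<in> ?C" if "y \<in> ?C" "z \<in> U" "(y, z) \<in> A" for y z
  proof -
    have "(y, z) \<in> A \<inter> U \<times> U" using that sub by blast
    then show ?thesis using that(1) by (auto intro: rtrancl_into_rtrancl)
  qed
  have "linked A ?C"
  proof (rule linkedI_root[OF assms(1)])
    show "x \<in> ?C" by simp
    fix y assume "y \<in> ?C"
    then have "(x, y) \<in> (A \<inter> U \<times> U)\<^sup>*" by simp
    then show "(x, y) \<in> (A \<inter> ?C \<times> ?C)\<^sup>*"
    proof induction
      case (step y z)
      then have "(y, z) \<in> A \<inter> ?C \<times> ?C" by (auto intro: rtrancl_into_rtrancl)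
      then show ?case using step.IH by (rule rtrancl_into_rtrancl[rotated])
    qed simp
  qed
  then show ?thesis using sub closed unfolding block_def by blast
qed

text \<open>The common part is closed under adjacency in each of the two linked sets, so if nonempty
  it equals both.\<close>

lemma block_disjoint:
  assumes "block A U C" "block A U D" "C \<noteq> D"
  shows "C \<inter> D = {}"
proof (rule ccontr)
  assume ne: "C \<inter> D \<noteq> {}"
  have "C \<inter> D = C" "C \<inter> D = D"
    using assms ne unfolding block_def
    by (intro linked_closed_subset[of A]; blast)+
  then show False using assms by blast
qed

text \<open>Everything is reached from \<open>s\<close>: the sets \<open>C\<close> and
  \<open>D\<close> through the neighbours \<open>y\<close> and \<open>z\<close>, and any further
  vertex through its neighbour in \<open>C\<close> or \<open>D\<close>.\<close>

lemma linked_if_joined: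
  assumes "sym A" "linked A C" "linked A D"
    and out: "\<And>x. x \<in> U \<Longrightarrow> x \<notin> C \<Longrightarrow> x \<notin> D \<Longrightarrow> \<exists>y \<in> C \<union> D. (x, y) \<in> A"
    and "C \<subseteq> U" "D \<subseteq> U"
    and s: "s \<in> U" "y \<in> C" "(s, y) \<in> A" "z \<in> D" "(s, z) \<in> A"
  shows "linked A U"
proof (rule linkedI_root[OF assms(1) s(1)])
  let ?P = "(A \<inter> U \<times> U)\<^sup>*"
  have "(A \<inter> C \<times> C)\<^sup>* \<subseteq> ?P" "(A \<inter> D \<times> D)\<^sup>* \<subseteq> ?P"
    using assms(5,6) by (intro rtrancl_mono; blast)+
  then have "\<And>w. w \<in> C \<Longrightarrow> (y, w) \<in> ?P" "\<And>w. w \<in> D \<Longrightarrow> (z, w) \<in> ?P"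
    using assms(2,3) s(2,4) unfolding linked_def by blast+
  moreover have "(s, y) \<in> A \<inter> U \<times> U" "(s, z) \<in> A \<inter> U \<times> U" using s assms(5,6) by auto
  ultimately have CD: "(s, w) \<in> ?P" if "w \<in> C \<union> D" for w
    using that by (auto intro: converse_rtrancl_into_rtrancl)
  fix x assume x: "x \<in> U"
  show "(s, x) \<in> ?P"
  proof (cases "x \<in> C \<union> D")
    case False
    then obtain w where w: "w \<in> C \<union> D" "(x, w) \<in> A" using out x by blast
    then have "(w, x) \<in> A \<inter> U \<times> U" using x assms(1,5,6) by (auto dest: symD)
    then show ?thesis using CD[OF w(1)] by (rule rtrancl_into_rtrancl[rotated])
  qed (use CD in auto)
qed

text \<open>A set \<open>S \<subseteq> Z\<close> containing \<open>R\<close> is a cut iff it contains every vertex of \<open>Z\<close> with neighbours in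
  both \<open>C\<close> and \<open>D\<close>, so these vertices form the only minimal cut.\<close>

lemma unique_minimal_cut_between:
  fixes H :: "'a pair_pre_digraph"
  defines "A \<equiv> parcs H" and "N \<equiv> pverts H"
  assumes symA: "sym A" and N: "N = C \<union> D \<union> Z" and disj: "C \<inter> D = {}" "(C \<union> D) \<inter> Z = {}"
    and linked: "linked A C" "linked A D" and sep: "A \<inter> C \<times> D = {}"
    and R: "R \<subseteq> Z" "\<And>r. r \<in> R \<Longrightarrow> A `` {r} \<inter> C \<noteq> {} \<and> A `` {r} \<inter> D \<noteq> {}"
    and Z: "\<And>z. z \<in> Z \<Longrightarrow> A `` {z} \<inter> (C \<union> D) \<noteq> {}"
    and indep: "A \<inter> (Z - R) \<times> (Z - R) = {}"
  shows "\<exists>!S. minimal_cut (with_proj H) S \<and> R \<subseteq> S \<and> S \<subseteq> Z"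
proof -
  define S0 where "S0 = {z \<in> Z. A `` {z} \<inter> C \<noteq> {} \<and> A `` {z} \<inter> D \<noteq> {}}"
  have RS0: "R \<subseteq> S0" using R by (auto simp: S0_def)
  \<comment> \<open>A vertex \<open>s\<close> of \<open>S0\<close> that is not deleted joins
    \<open>C\<close> to \<open>D\<close>, and the other remaining vertices of \<open>Z\<close> are
    attached to one of these.\<close>
  have joined: "linked A (N - T)" if T: "T \<subseteq> Z" "\<not> S0 \<subseteq> T" for T
  proof -
    obtain s y z where s: "s \<in> Z" "s \<notin> T" "y \<in> C" "(s, y) \<in> A" "z \<in> D" "(s, z) \<in> A"
      using T(2) by (auto simp: S0_def)
    show ?thesis
    proof (rule linked_if_joined[OF symA linked, of "N - T" s y z])
      show "\<exists>y\<in>C \<union> D. (x, y) \<in> A" if "x \<in> N - T" "x \<notin> C" "x \<notin> D" for x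
        using Z[of x] that N by auto
    qed (use s N T disj in auto)
  qed
  have cut: "\<not> linked A (N - S0)"
  proof
    assume l: "linked A (N - S0)"
    \<comment> \<open>\<open>C\<close> with the undeleted vertices of \<open>Z\<close> attached to
      it. These are not in \<open>S0\<close> and so have no neighbour in \<open>D\<close>, and they
      are pairwise nonadjacent since \<open>Z - R\<close> is independent; hence the set is closed
      under adjacency.\<close>
    let ?C = "C \<union> {z \<in> Z - S0. A `` {z} \<inter> C \<noteq> {}}"
    have "?C = N - S0"
    proof (rule linked_closed_subset[OF l])
      show "?C \<subseteq> N - S0" using N disj by (auto simp: S0_def)
      show "?C \<noteq> {}" using linked(1) by (auto simp: linked_def)
    next
      fix y z assume yz: "y \<in> ?C" "z \<in> N - S0" "(y, z) \<in> A"
      show "z \<in> ?C"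
      proof (cases "y \<in> C")
        case True
        then have "z \<notin> D" using sep yz(3) by blast
        moreover have "(z, y) \<in> A" using symA yz(3) by (auto dest: symD)
        ultimately show ?thesis using yz(2) N True by blast
      next
        case False
        then have y: "y \<in> Z - S0" "A `` {y} \<inter> C \<noteq> {}" using yz(1) by auto
        then have "z \<notin> D" using yz(3) by (auto simp: S0_def)
        moreover have "z \<notin> Z" using indep y(1) yz(2,3) RS0 by blast
        ultimately show ?thesis using yz(2) N by blast
      qed
    qed
    moreover have "D \<inter> ?C = {}" "D \<subseteq> N - S0" "D \<noteq> {}"
      using disj N linked(2) by (auto simp: S0_def linked_def)
    ultimately show False by blast
  qed
  have mc: "minimal_cut (with_proj H) S \<longleftrightarrow> S \<subset> N \<and> \<not> linked A (N - S) \<and> (\<forall>T \<subset> S. linked A (N - T))" for S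
    using minimal_cut_iff_linked[of H] symA by (simp add: A_def N_def)
  have S0Z: "S0 \<subseteq> Z" by (auto simp: S0_def)
  moreover have "C \<noteq> {}" using linked(1) by (simp add: linked_def)
  ultimately have "S0 \<subset> N" using N disj by blast
  show ?thesis
  proof (rule ex1I[of _ S0])
    show "minimal_cut (with_proj H) S0 \<and> R \<subseteq> S0 \<and> S0 \<subseteq> Z"
      unfolding mc using \<open>S0 \<subset> N\<close> cut RS0 S0Z joined by blast
    fix S assume S: "minimal_cut (with_proj H) S \<and> R \<subseteq> S \<and> S \<subseteq> Z"
    \<comment> \<open>If \<open>S\<close> missed a vertex of \<open>S0\<close>, it would not
      disconnect. If it properly contained \<open>S0\<close>, it would not be minimal, since
      deleting \<open>S0\<close> already disconnects.\<close>
    then have "S0 \<subseteq> S" using joined mc by blast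
    then show "S = S0" using S cut mc by blast
  qed
qed

subsection \<open>Cuts of plane graphs\<close>

lemma path_connected_arc_minus_end:
  fixes g :: "real \<Rightarrow> 'a::real_normed_vector"
  assumes "arc g" "q = pathstart g \<or> q = pathfinish g"
  shows "path_connected (path_image g - {q})"
proof -
  have cont: "continuous_on {0..1} g" and inj: "inj_on g {0..1}"
    using assms(1) by (auto simp: arc_def path_def)
  have "path_connected (g ` ({0..1} - {t}))" if "t = 0 \<or> t = 1" for t
  proof (intro path_connected_continuous_image continuous_on_subset[OF cont])
    have "{0..1} - {0} = {0<..1::real}" "{0..1} - {1} = {0..<1::real}" by auto
    then show "path_connected ({0..1} - {t})"
      using that by (auto intro!: convex_imp_path_connected)
  qed auto
  moreover have "g ` ({0..1} - {t}) = path_image g - {g t}" if "t \<in> {0..1}" for t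
    unfolding path_image_def using inj_on_image_set_diff[OF inj, of "{0..1}" "{t}"] that by auto
  ultimately show ?thesis
    using assms(2) unfolding pathstart_def pathfinish_def by (metis atLeastAtMost_iff order_refl zero_le_one)
qed

text \<open>The part of the drawing that belongs to a component \<open>C\<close> of
  \<open>G - R\<close>: its vertices and all edges at them, without their ends in \<open>R\<close>.
  Leaving out \<open>R\<close> makes the patches of different components disjoint, while each
  \<open>r\<close> can be added to several patches.\<close>

definition patch :: "complex set set \<Rightarrow> complex set \<Rightarrow> complex set \<Rightarrow> complex set" where
  "patch E R C = C \<union> (\<Union>{e \<in> E. e \<inter> C \<noteq> {}} - R)"

lemma sym_graph_of: "sym (parcs (graph_of V E))"
  by (auto simp: sym_def graph_of_def insert_commute)

context plane_graph
begin

abbreviation "adj \<equiv> parcs (graph_of V E)"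

lemma edge_ends:
  assumes "e \<in> E"
  obtains p q where "e \<inter> V = {p, q}" "p \<noteq> q" "(p, q) \<in> adj" "path_connected e" "path_connected (e - {p})"
    "path_connected (e - {q})"
proof -
  obtain g where g: "arc g" "path_image g = e" "e \<inter> V = {pathstart g, pathfinish g}"
    using edge_arc[OF assms] by blast
  show thesis
    by (rule that[of "pathstart g" "pathfinish g"])
       (use g assms arc_distinct_ends[OF g(1)] path_connected_arc_minus_end[OF g(1)] in
         \<open>auto simp: graph_of_def path_connected_path_image arc_imp_path\<close>)
qed

lemma adj_in_V: "(u, v) \<in> adj \<Longrightarrow> u \<in> V \<and> v \<in> V"
  by (auto simp: graph_of_def)

text \<open>An edge at \<open>C\<close> has its other end in \<open>C\<close> or in
  \<open>R\<close>, because \<open>C\<close> is closed under adjacency in \<open>V - R\<close>.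
  Removing \<open>R\<close> therefore costs the edge at most one end point.\<close>

lemma edge_at_block:
  assumes "block adj (V - R) C" "e \<in> E" "e \<inter> C \<noteq> {}"
    and "R \<subseteq> V"
  shows "e \<inter> V \<subseteq> C \<union> R" "e - R \<subseteq> patch E R C" "path_connected (e - R)"
proof -
  obtain p q where pq: "e \<inter> V = {p, q}" "p \<in> C" "(p, q) \<in> adj" "path_connected e"
      "path_connected (e - {q})"
  proof (rule edge_ends[OF assms(2)])
    fix p q
    assume *: "e \<inter> V = {p, q}" "(p, q) \<in> adj" "path_connected e" "path_connected (e - {p})"
      "path_connected (e - {q})"
    have "e \<inter> C \<subseteq> {p, q}" using assms(1) *(1) by (auto simp: block_def)
    then have "p \<in> C \<or> q \<in> C" using assms(3) by blast
    moreover have "(q, p) \<in> adj" using *(2) sym_graph_of by (auto dest: symD)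
    ultimately show thesis using * that[of p q] that[of q p] by (auto simp: insert_commute)
  qed
  have p: "p \<in> V" "p \<notin> R" using pq assms(1) by (auto simp: block_def)
  have "q \<in> C \<union> R" using pq assms(1) by (auto simp: block_def)
  then show "e \<inter> V \<subseteq> C \<union> R" using pq by auto
  show "path_connected (e - R)"
  proof (cases "q \<in> R")
    case True
    then have "e - R = e - {q}" using assms(4) p pq(1) by auto
    then show ?thesis using pq by simp
  next
    case False
    then have "e - R = e" using assms(4) p pq(1) by auto
    then show ?thesis using pq by simp
  qed
  show "e - R \<subseteq> patch E R C" using assms(2,3) by (auto simp: patch_def)
qed

lemma path_connected_patch:
  assumes "block adj (V - R) C" "R \<subseteq> V"
  shows "path_connected (patch E R C)"
proof -
  let ?U = "patch E R C"
  let ?c = "path_component ?U"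
  have edge: "?c x y" if "e \<in> E" "e \<inter> C \<noteq> {}" "x \<in> e - R" "y \<in> e - R" for e x y
  proof -
    have "e - R \<subseteq> ?U" "path_connected (e - R)"
      using edge_at_block[OF assms(1) that(1,2) assms(2)] by auto
    then show ?thesis
      using that(3,4) path_component_of_subset unfolding path_connected_component by metis
  qed
  obtain w where w: "w \<in> C" using assms(1) by (auto simp: block_def linked_def)
  have CU: "C \<subseteq> ?U" by (auto simp: patch_def)
  have C: "?c w y" if "y \<in> C" for y
  proof -
    have "(w, y) \<in> (adj \<inter> C \<times> C)\<^sup>*"
      using assms(1) w that by (auto simp: block_def linked_def)
    then show ?thesis
    proof induction
      case base
      then show ?case using w CU by (auto intro: path_component_refl)
    next
      case (step y z)
      obtain e where e: "e \<in> E" "e \<inter> V = {y, z}" using step(2) by (auto simp: graph_of_def)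
      have "?c y z"
        by (rule edge[OF e(1)]) (use e step(2) assms(1) in \<open>auto simp: block_def\<close>)
      then show ?case using step.IH path_component_trans by metis
    qed
  qed
  have "?c w z" if "z \<in> ?U" for z
  proof (cases "z \<in> C")
    case False
    then obtain e where e: "e \<in> E" "e \<inter> C \<noteq> {}" "z \<in> e - R" using \<open>z \<in> ?U\<close> by (auto simp: patch_def)
    then obtain p where "p \<in> C" "p \<in> e" by auto
    then have "?c p z" using edge[OF e(1,2) _ e(3)] assms(1) by (auto simp: block_def)
    then show ?thesis using C[OF \<open>p \<in> C\<close>] path_component_trans by metis
  qed (use C in auto)
  then show ?thesis
    unfolding path_connected_component using path_component_sym path_component_trans by metis
qed

text \<open>An edge from \<open>r\<close> to \<open>C\<close> lies in the patch except for
  \<open>r\<close>, so adding \<open>r\<close> amounts to adding this edge.\<close>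

lemma path_connected_insert_patch:
  assumes "block adj (V - R) C" "R \<subseteq> V" "r \<in> R" "(r, y) \<in> adj" "y \<in> C"
  shows "path_connected (insert r (patch E R C))" "r \<in> closure (patch E R C)"
proof -
  let ?U = "patch E R C"
  obtain e where e: "e \<in> E" "e \<inter> V = {r, y}" using assms(4) by (auto simp: graph_of_def)
  have "y \<notin> R" using assms by (auto simp: block_def)
  have "e - {r} \<subseteq> ?U"
  proof -
    have "e \<inter> R \<subseteq> {r}" using e assms(2) \<open>y \<notin> R\<close> by blast
    then show ?thesis using e assms(5) by (auto simp: patch_def)
  qed
  then have "insert r ?U = ?U \<union> e" using e by auto
  moreover have "path_connected (?U \<union> e)"
  proof (rule path_connected_Un)
    show "path_connected e" using edge_ends[OF e(1)] by metis
    show "?U \<inter> e \<noteq> {}" using e assms(5) by (auto simp: patch_def)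
  qed (rule path_connected_patch[OF assms(1,2)])
  ultimately show pc: "path_connected (insert r ?U)" by simp
  have "y \<in> ?U" "y \<noteq> r" using assms \<open>y \<notin> R\<close> by (auto simp: patch_def)
  then have "r islimpt insert r ?U"
    by (intro connected_imp_perfect path_connected_imp_connected pc) auto
  then show "r \<in> closure ?U"
    by (simp add: islimpt_insert closure_def)
qed

text \<open>Vertices in a patch belong to its block. A common point that is no vertex lies on a
  single edge meeting both blocks, as distinct edges meet in vertices only; but the ends of an edge
  at \<open>C\<close> lie in \<open>C\<close> or \<open>R\<close>.\<close>

lemma patch_disjoint:
  assumes "block adj (V - R) C" "block adj (V - R) D" "C \<noteq> D" "R \<subseteq> V"
  shows "patch E R C \<inter> patch E R D = {}"
proof (rule ccontr)
  assume "patch E R C \<inter> patch E R D \<noteq> {}"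
  then obtain z where z: "z \<in> patch E R C" "z \<in> patch E R D" by blast
  note CD = block_disjoint[OF assms(1-3)]
  have inC: "z \<in> B" if z: "z \<in> patch E R B" "z \<in> V" "block adj (V - R) B" for B
  proof (rule ccontr)
    assume "z \<notin> B"
    then obtain e where e: "e \<in> E" "e \<inter> B \<noteq> {}" "z \<in> e" "z \<notin> R" using z(1) by (auto simp: patch_def)
    have "e \<inter> V \<subseteq> B \<union> R" using edge_at_block(1)[OF z(3) e(1,2) assms(4)] .
    then show False using e z(2) \<open>z \<notin> B\<close> by blast
  qed
  show False
  proof (cases "z \<in> V")
    case True
    then show False using inC z assms CD by blast
  next
    case False
    then have "z \<notin> C" "z \<notin> D" using assms by (auto simp: block_def)
    then obtain e f where e: "e \<in> E" "e \<inter> C \<noteq> {}" "z \<in> e" and f: "f \<in> E" "f \<inter> D \<noteq> {}" "z \<in> f"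
      using z by (auto simp: patch_def)
    then have "e = f" using edge_disjoint[of e f] False by blast
    have "e \<inter> V \<subseteq> C \<union> R" using edge_at_block(1)[OF assms(1) e(1,2) assms(4)] .
    moreover have "D \<subseteq> V - R" using assms by (simp add: block_def)
    ultimately show False using f(2) \<open>e = f\<close> CD by blast
  qed
qed

lemma patch_avoids: "C \<inter> R = {} \<Longrightarrow> patch E R C \<inter> R = {}"
  by (auto simp: patch_def)

text \<open>The vertices of the bounding cycle are distinct and lie on the frontier. This supplies
  the three points for \<open>K\<^sub>3\<^sub>,\<^sub>3\<close>.\<close>

lemma card_large_face_boundary:
  assumes "W \<in> large_faces V E"
  shows "card (V \<inter> frontier W) \<ge> 4"
proof -
  obtain p where p: "bounding_cycle V E W p" "length p \<ge> 4"
    using assms by (auto simp: large_faces_def)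
  let ?G = "with_proj (graph_of V E)"
  obtain u where u: "pre_digraph.awalk ?G u p u" "distinct (tl (pre_digraph.awalk_verts ?G u p))" "p \<noteq> []"
    using p(1) by (auto simp: bounding_cycle_def pre_digraph.cycle_def)
  have "pre_digraph.cas ?G u p u" using u(1) by (simp add: pre_digraph.awalk_def)
  \<comment> \<open>Dropping the first vertex, which the closed walk repeats at its end, leaves the
    heads of the arcs.\<close>
  then have "pre_digraph.awalk_verts ?G u p = fst (hd p) # map snd p"
    using pre_digraph.awalk_verts_conv'[of ?G u p u] u(3) by simp
  then have "card (snd ` set p) = length p"
    using u(2) distinct_card[of "map snd p"] by simp
  moreover have "snd ` set p \<subseteq> V \<inter> frontier W"
  proof
    fix v assume "v \<in> snd ` set p"
    then obtain w where w: "(w, v) \<in> set p" by auto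
    then have "(w, v) \<in> adj" using u(1) by (auto simp: pre_digraph.awalk_def)
    then obtain e where e: "e \<in> E" "e \<inter> V = {w, v}" by (auto simp: graph_of_def)
    moreover have "e \<subseteq> frontier W" using p(1) w e by (auto simp: bounding_cycle_def)
    ultimately show "v \<in> V \<inter> frontier W" by blast
  qed
  ultimately have "length p \<le> card (V \<inter> frontier W)"
    using card_mono[of "V \<inter> frontier W" "snd ` set p"] finite_V by simp
  then show ?thesis using p(2) by simp
qed

text \<open>Three points of \<open>B\<close> against the two patches and \<open>X\<close> would give
  \<open>K\<^sub>3\<^sub>,\<^sub>3\<close>. Here \<open>X\<close> stands for a third component of
  \<open>G - R\<close> or for a face whose boundary vertices all lie in \<open>R\<close>.\<close>

lemma two_blocks_exclude_third:
  assumes C: "block adj (V - R) C" and D: "block adj (V - R) D" "C \<noteq> D" and R: "R \<subseteq> V"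
    and nbrs: "\<And>r. r \<in> R \<Longrightarrow> adj `` {r} \<inter> C \<noteq> {} \<and> adj `` {r} \<inter> D \<noteq> {}"
    and B: "B \<subseteq> R" "card B \<ge> 3"
    and X: "connected X" "X \<inter> (patch E R C \<union> patch E R D \<union> R) = {}" "B \<subseteq> closure X"
  shows False
proof -
  obtain B' where "B' \<subseteq> B" "card B' = 3" using B(2) by (metis obtain_subset_with_card_n)
  then obtain a b c where abc: "a \<noteq> b" "a \<noteq> c" "b \<noteq> c" "{a, b, c} \<subseteq> B"
    by (auto simp: card_3_iff)
  have pc: "path_connected (insert r (patch E R C))" "path_connected (insert r (patch E R D))"
    if "r \<in> R" for r
    using nbrs[OF that] path_connected_insert_patch(1)[OF _ R that] C D by blast+
  have CR: "C \<inter> R = {}" "D \<inter> R = {}" "C \<noteq> {}" "D \<noteq> {}"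
    using C D by (auto simp: block_def linked_def)
  show False
  proof (rule no_plane_K33[OF abc(1-3), of "patch E R C" "patch E R D" X])
    show "patch E R C \<noteq> {}" "patch E R D \<noteq> {}" using CR by (auto simp: patch_def)
    show "patch E R C \<inter> patch E R D = {}" using patch_disjoint[OF C D R] .
    show "{a, b, c} \<inter> (patch E R C \<union> patch E R D) = {}"
      using abc B patch_avoids[OF CR(1)] patch_avoids[OF CR(2)] by blast
    show "X \<inter> (patch E R C \<union> patch E R D \<union> {a, b, c}) = {}" "{a, b, c} \<subseteq> closure X"
      using X abc B by blast+
  qed (use pc abc B X in auto)
qed

lemma minimal_cut_splits:
  assumes k: "k_connected 3 (graph_of V E)" and R: "minimal_cut (graph_of V E) R"
  obtains C D where "block adj (V - R) C" "block adj (V - R) D" "C \<noteq> D" "R \<subseteq> V" "V - R = C \<union> D"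
    "\<And>r. r \<in> R \<Longrightarrow> adj `` {r} \<inter> C \<noteq> {} \<and> adj `` {r} \<inter> D \<noteq> {}"
    "\<And>W. W \<in> large_faces V E \<Longrightarrow> \<not> V \<inter> frontier W \<subseteq> R"
proof -
  have pv: "pverts (graph_of V E) = V" by (simp add: graph_of_def)
  have cut: "R \<subset> V" "\<not> linked adj (V - R)" "\<And>T. T \<subset> R \<Longrightarrow> linked adj (V - T)"
    using R minimal_cut_iff_linked[OF sym_graph_of] pv by auto
  have card: "card R \<ge> 3"
  proof (rule ccontr)
    assume "\<not> 3 \<le> card R"
    then have "linked adj (V - R)"
      using k cut(1) connected_induce_iff_linked[OF sym_graph_of] pv by (auto simp: k_connected_def)
    then show False using cut by simp
  qed
  \<comment> \<open>If \<open>r\<close> had no neighbour in \<open>C\<close>, then \<open>C\<close>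
    would be closed under adjacency in \<open>V - (R - {r})\<close>, which is linked by minimality
    of \<open>R\<close>. So \<open>C\<close> would be that whole set, although it lacks
    \<open>r\<close>.\<close>
  have nbr: "adj `` {r} \<inter> C \<noteq> {}" if r: "r \<in> R" and C: "block adj (V - R) C" for r C
  proof (rule ccontr)
    assume no: "\<not> adj `` {r} \<inter> C \<noteq> {}"
    have "C = V - (R - {r})"
    proof (rule linked_closed_subset)
      show "linked adj (V - (R - {r}))" using cut(3)[of "R - {r}"] r by auto
      fix y z assume yz: "y \<in> C" "z \<in> V - (R - {r})" "(y, z) \<in> adj"
      then have "z \<noteq> r" using no sym_graph_of by (auto dest: symD)
      then show "z \<in> C" using yz C by (auto simp: block_def)
    qed (use C in \<open>auto simp: block_def linked_def\<close>)
    then show False using r cut(1) C by (auto simp: block_def)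
  qed
  obtain x where x: "x \<in> V - R" using cut(1) by blast
  obtain C where C: "block adj (V - R) C" using ex_block[OF sym_graph_of x] by blast
  then have "C \<noteq> V - R" using cut(2) by (auto simp: block_def)
  then obtain y where y: "y \<in> V - R" "y \<notin> C" using C by (auto simp: block_def)
  obtain D where D: "block adj (V - R) D" "y \<in> D" using ex_block[OF sym_graph_of y(1)] by blast
  have "C \<noteq> D" using D y by blast
  have R': "R \<subseteq> V" using cut by blast
  note excl = two_blocks_exclude_third[OF C D(1) \<open>C \<noteq> D\<close> R']
  have "V - R = C \<union> D"
  proof (rule ccontr)
    assume "V - R \<noteq> C \<union> D"
    then obtain z where z: "z \<in> V - R" "z \<notin> C \<union> D" using C D by (auto simp: block_def)
    \<comment> \<open>The patch of a third component takes the role of \<open>X\<close>, with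
      \<open>R\<close> as \<open>B\<close>.\<close>
    obtain F where F: "block adj (V - R) F" "z \<in> F" using ex_block[OF sym_graph_of z(1)] by blast
    show False
    proof (rule excl)
      show "connected (patch E R F)"
        by (intro path_connected_imp_connected path_connected_patch F R')
      have "F \<inter> R = {}" using F by (auto simp: block_def)
      moreover have "C \<noteq> F" "D \<noteq> F" using F z by auto
      ultimately show "patch E R F \<inter> (patch E R C \<union> patch E R D \<union> R) = {}"
        using patch_disjoint[OF C F(1) _ R'] patch_disjoint[OF D(1) F(1) _ R'] patch_avoids by blast
      show "R \<subseteq> closure (patch E R F)"
        using nbr[OF _ F(1)] path_connected_insert_patch(2)[OF F(1) R'] by blast
    qed (use nbr C D card in auto)
  qed
  moreover have "\<not> V \<inter> frontier W \<subseteq> R" if W: "W \<in> large_faces V E" for W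
  proof
    assume sub: "V \<inter> frontier W \<subseteq> R"
    \<comment> \<open>The face itself takes the role of \<open>X\<close>: it is connected, misses
      the drawing and accumulates at its boundary vertices.\<close>
    have W': "W \<in> components (- (V \<union> \<Union>E))" using W by (auto simp: large_faces_def faces_def)
    show False
    proof (rule excl)
      show "V \<inter> frontier W \<subseteq> R" by fact
      show "3 \<le> card (V \<inter> frontier W)" using card_large_face_boundary[OF W] by simp
      show "connected W" using W' by (rule in_components_connected)
      have "patch E R C \<union> patch E R D \<union> R \<subseteq> V \<union> \<Union>E"
        using C D R' by (auto simp: patch_def block_def)
      then show "W \<inter> (patch E R C \<union> patch E R D \<union> R) = {}"
        using in_components_subset[OF W'] by blast
      show "V \<inter> frontier W \<subseteq> closure W" by (auto simp: frontier_def)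
    qed (use nbr C D in auto)
  qed
  ultimately show thesis using that C D \<open>C \<noteq> D\<close> R' nbr by blast
qed

end

section \<open>Cuts of the auxiliary graph over a cut of \<open>G\<close>\<close>

theorem theorem19:
  fixes V :: "complex set" and E :: "complex set set" and c :: "complex set \<Rightarrow> complex"
  assumes "plane_graph V E"
    and "k_connected 3 (graph_of V E)"
    and "\<And>W. W \<in> large_faces V E \<Longrightarrow> c W \<in> W"
    and "minimal_cut (graph_of V E) R"
  shows "\<exists>!S. minimal_cut (nabla V E c) S \<and> S \<inter> V = R"
proof -
  interpret plane_graph V E by fact
  obtain C D where CD: "block adj (V - R) C" "block adj (V - R) D" "C \<noteq> D" "R \<subseteq> V" "V - R = C \<union> D"
    "\<And>r. r \<in> R \<Longrightarrow> adj `` {r} \<inter> C \<noteq> {} \<and> adj `` {r} \<inter> D \<noteq> {}"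
    "\<And>W. W \<in> large_faces V E \<Longrightarrow> \<not> V \<inter> frontier W \<subseteq> R"
    using minimal_cut_splits[OF assms(2,4)] by blast
  define F where "F = c ` large_faces V E"
  let ?H = "nabla V E c"
  have FV: "F \<inter> V = {}"
  proof -
    have "c W \<notin> V" if "W \<in> large_faces V E" for W
      using assms(3)[OF that] that in_components_subset[of W "- (V \<union> \<Union>E)"]
      by (auto simp: large_faces_def faces_def)
    then show ?thesis by (auto simp: F_def)
  qed
  have pv: "pverts ?H = V \<union> F" by (simp add: nabla_def F_def)
  have adj: "adj \<subseteq> parcs ?H" by (auto simp: nabla_def)
  have arcs: "(u, v) \<in> adj \<or> u \<in> F \<and> v \<in> V \<or> u \<in> V \<and> v \<in> F" if "(u, v) \<in> parcs ?H" for u v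
    using that by (auto simp: nabla_def F_def)
  have VV: "(u, v) \<in> adj" if "(u, v) \<in> parcs ?H" "u \<in> V" "v \<in> V" for u v
    using arcs[OF that(1)] that(2,3) FV by blast
  have sub: "C \<subseteq> V" "D \<subseteq> V" "(C \<union> D) \<inter> R = {}" using CD by blast+
  have CDdisj: "C \<inter> D = {}" using block_disjoint[OF CD(1-3)] .
  \<comment> \<open>For \<open>S\<close> inside \<open>V \<union> F\<close>, the condition
    \<open>S \<inter> V = R\<close> says that \<open>S\<close> lies between \<open>R\<close> and
    \<open>R \<union> F\<close>, so \<open>Z\<close> is taken to be
    \<open>R \<union> F\<close>.\<close>
  have "\<exists>!S. minimal_cut ?H S \<and> R \<subseteq> S \<and> S \<subseteq> R \<union> F"
  proof (rule unique_minimal_cut_between)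
    show "sym (parcs ?H)"
      using sym_graph_of[of V E] unfolding nabla_def sym_def by auto
    show "pverts ?H = C \<union> D \<union> (R \<union> F)" using pv CD by blast
    show "C \<inter> D = {}" by (fact CDdisj)
    show "(C \<union> D) \<inter> (R \<union> F) = {}" using FV sub by blast
    show "linked (parcs ?H) C" "linked (parcs ?H) D"
      using CD(1,2) adj by (auto simp: block_def intro: linked_mono)
    show "parcs ?H \<inter> C \<times> D = {}"
      using VV sub CD(1,2) CDdisj unfolding block_def by blast
    show "parcs ?H `` {r} \<inter> C \<noteq> {} \<and> parcs ?H `` {r} \<inter> D \<noteq> {}" if "r \<in> R" for r
      using CD(6)[OF that] adj by blast
    show "parcs ?H `` {z} \<inter> (C \<union> D) \<noteq> {}" if z: "z \<in> R \<union> F" for z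
    proof (cases "z \<in> R")
      case True
      then show ?thesis using CD(6) adj by blast
    next
      case False
      then obtain W where W: "W \<in> large_faces V E" "z = c W" using z by (auto simp: F_def)
      \<comment> \<open>The boundary of a large face is not contained in \<open>R\<close>, so one of
        its vertices remains in \<open>C\<close> or \<open>D\<close>.\<close>
      then obtain v where v: "v \<in> V \<inter> frontier W" "v \<notin> R" using CD(7) by blast
      then have "v \<in> C \<union> D" "(z, v) \<in> parcs ?H" using CD(5) W by (auto simp: nabla_def)
      then show ?thesis by blast
    qed
    \<comment> \<open>Added vertices are joined to vertices of \<open>G\<close> only.\<close>
    show "parcs ?H \<inter> (R \<union> F - R) \<times> (R \<union> F - R) = {}"
      using arcs adj_in_V FV by blast
  qed auto
  moreover have "minimal_cut ?H S \<and> R \<subseteq> S \<and> S \<subseteq> R \<union> F \<longleftrightarrow> minimal_cut ?H S \<and> S \<inter> V = R" for S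
  proof -
    have "S \<subseteq> V \<union> F" if "minimal_cut ?H S"
      using that pv by (auto simp: minimal_cut_def vertex_cut_def)
    then show ?thesis using FV CD(4) by blast
  qed
  ultimately show ?thesis by simp
qed

end
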